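(* Let $\psi_1,\psi_2$ be convex LTL$_F$ specifications and $M\in\mathbb{N}$ with $M\le N$, where $N$ is the length of the trajectories of the LTL$_F$ specifications $\psi_1,\psi_2$. Let $\psi$ be constructed with the grammar $$\psi:=\psi_1\mid\psi_1\wedge\psi_2\mid\bigcirc\psi_1\mid\bigcirc^M\psi_1\mid\square\psi_1\mid\square^M\psi_1.$$ Then the specification $\psi$ is a convex specification.
   Context: Let $X\subseteq\mathbb{R}^n$ be the state space, $\mathsf{AP}$ a finite set of atomic propositions and $L:X\to 2^{\mathsf{AP}}$ a measurable labeling function. LTL$_F$ formulas over $\mathsf{AP}$ are built inductively as $\psi::=\mathsf{true}\mid p\mid\neg\psi\mid\psi_1\wedge\psi_2\mid\psi_1\vee\psi_2\mid\bigcirc\psi\mid\psi_1\,\mathsf{U}\,\psi_2\mid\square\psi\mid\lozenge\psi$ with $p\in\mathsf{AP}$. For a finite word $\omega=(\omega_0,\dots,\omega_{N-1})$ of length $N$ with letters in $2^{\mathsf{AP}}$, satisfaction at step $i<N$ is defined by: $\omega_i\vDash\mathsf{true}$ always holds; $\omega_i\vDash p$ if $p\in\omega_i$; $\omega_i\vDash\neg\psi$ if $\omega_i\nvDash\psi$; $\wedge$ and $\vee$ are interpreted as "and" and "or"; $\omega_i\vDash\bigcirc\psi$ if $\omega_{i+1}\vDash\psi$; $\omega_i\vDash\psi_1\,\mathsf{U}\,\psi_2$ if for some $m$ with $i\le m<N$ we have $\omega_m\vDash\psi_2$ and $\omega_k\vDash\psi_1$ for all $i\le k<m$; $\omega_i\vDash\square\psi$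 if $\omega_m\vDash\psi$ for all $i\le m<N$; $\omega_i\vDash\lozenge\psi$ if $\omega_m\vDash\psi$ for some $i\le m<N$. The bounded operators are defined for $0\le j<N-i$ by: $\omega_i\vDash\bigcirc^j\psi$ if $\omega_{i+j}\vDash\psi$; $\omega_i\vDash\square^j\psi$ if $\omega_m\vDash\psi$ for all $i\le m\le i+j$. One writes $\omega\vDash\psi$ iff $\omega_0\vDash\psi$. A trajectory $w=(x_0,\dots,x_{N-1})\in X^N$ satisfies $\psi$ iff the word $(L(x_0),\dots,L(x_{N-1}))$ does. An LTL$_F$ formula $\psi$ is convex if for all trajectories $w_1,w_2$ with $w_1\vDash\psi$ and $w_2\vDash\psi$, any trajectory $w=\lambda w_1+(1-\lambda)w_2$ (componentwise) with $\lambda\in[0,1]$ satisfies $w\vDash\psi$.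
   Formalization: Convexity is assumed and proved for trajectories of every length from 1 to N, not only of length N: with length exactly N the claim fails (N=2, "next true or p" with p non-convex); operators reaching past the end of the word count as false. *)

theory Defs
  imports "HOL-Analysis.Analysis"
begin

text \<open>\<open>LNextB j\<close> and \<open>LAlwaysB j\<close> are the bounded operators written with a superscript \<open>j\<close>.\<close>

datatype (atoms: 'ap) ltlf =
    LTrue
  | LAtom 'ap
  | LNot "'ap ltlf"
  | LAnd "'ap ltlf" "'ap ltlf"
  | LOr "'ap ltlf" "'ap ltlf"
  | LNext "'ap ltlf"
  | LUntil "'ap ltlf" "'ap ltlf"
  | LAlways "'ap ltlf"
  | LEventually "'ap ltlf"
  | LNextB nat "'ap ltlf"
  | LAlwaysB nat "'ap ltlf"

text \<open>Satisfaction at step \<open>i\<close>, meaningful for \<open>i < length \<omega>\<close>. An operator that refers to a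
  letter beyond the end of the word is not satisfied (strong next); in particular the bounded
  operators are false when \<open>j\<close> is outside the range \<open>0 \<le> j < length \<omega> - i\<close>.\<close>

primrec sat_at :: "'ap set list \<Rightarrow> nat \<Rightarrow> 'ap ltlf \<Rightarrow> bool" where
  "sat_at \<omega> i LTrue \<longleftrightarrow> True"
| "sat_at \<omega> i (LAtom p) \<longleftrightarrow> p \<in> \<omega> ! i"
| "sat_at \<omega> i (LNot \<psi>) \<longleftrightarrow> \<not> sat_at \<omega> i \<psi>"
| "sat_at \<omega> i (LAnd \<psi>1 \<psi>2) \<longleftrightarrow> sat_at \<omega> i \<psi>1 \<and> sat_at \<omega> i \<psi>2"
| "sat_at \<omega> i (LOr \<psi>1 \<psi>2) \<longleftrightarrow> sat_at \<omega> i \<psi>1 \<or> sat_at \<omega> i \<psi>2"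
| "sat_at \<omega> i (LNext \<psi>) \<longleftrightarrow> i + 1 < length \<omega> \<and> sat_at \<omega> (i + 1) \<psi>"
| "sat_at \<omega> i (LUntil \<psi>1 \<psi>2) \<longleftrightarrow>
     (\<exists>m. i \<le> m \<and> m < length \<omega> \<and> sat_at \<omega> m \<psi>2 \<and> (\<forall>k. i \<le> k \<and> k < m \<longrightarrow> sat_at \<omega> k \<psi>1))"
| "sat_at \<omega> i (LAlways \<psi>) \<longleftrightarrow> (\<forall>m. i \<le> m \<and> m < length \<omega> \<longrightarrow> sat_at \<omega> m \<psi>)"
| "sat_at \<omega> i (LEventually \<psi>) \<longleftrightarrow> (\<exists>m. i \<le> m \<and> m < length \<omega> \<and> sat_at \<omega> m \<psi>)"
| "sat_at \<omega> i (LNextB j \<psi>) \<longleftrightarrow> i + j < length \<omega> \<and> sat_at \<omega> (i + j) \<psi>"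
| "sat_at \<omega> i (LAlwaysB j \<psi>) \<longleftrightarrow>
     i + j < length \<omega> \<and> (\<forall>m. i \<le> m \<and> m \<le> i + j \<longrightarrow> sat_at \<omega> m \<psi>)"

definition sat :: "('s \<Rightarrow> 'ap set) \<Rightarrow> 's list \<Rightarrow> 'ap ltlf \<Rightarrow> bool" where
  "sat L w \<psi> \<longleftrightarrow> sat_at (map L w) 0 \<psi>"

definition trajectories :: "'s set \<Rightarrow> nat \<Rightarrow> 's list set" where
  "trajectories X k = {w. length w = k \<and> set w \<subseteq> X}"

definition traj_comb :: "real \<Rightarrow> 's::real_vector list \<Rightarrow> 's list \<Rightarrow> 's list" where
  "traj_comb t w1 w2 = map2 (\<lambda>x y. t *\<^sub>R x + (1 - t) *\<^sub>R y) w1 w2"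

text \<open>Convexity of a specification over a horizon \<open>N\<close>: the condition ranges over all pairs of
  nonempty trajectories of equal length up to \<open>N\<close>, not of length exactly \<open>N\<close>. Evaluating a
  formula at step \<open>i\<close> of a trajectory of length \<open>N\<close> amounts to evaluating it on the suffix of
  length \<open>N - i\<close>, and convexity for length \<open>N\<close> alone says nothing about these suffixes (the
  formula \<open>LOr (LNext LTrue) (LAtom p)\<close> holds on every trajectory of length 2 but is just \<open>p\<close> on
  those of length 1). Convexity for trajectories of every length is convexity for every \<open>N\<close>.
  A convex combination that leaves the state space is not a trajectory and carries no condition.\<close>

definition convex_spec ::
    "'s::real_vector set \<Rightarrow> ('s \<Rightarrow> 'ap set) \<Rightarrow> nat \<Rightarrow> 'ap ltlf \<Rightarrow> bool" where
  "convex_spec X L N \<psi> \<longleftrightarrow>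
     (\<forall>k. 1 \<le> k \<and> k \<le> N \<longrightarrow>
       (\<forall>w1 \<in> trajectories X k. \<forall>w2 \<in> trajectories X k. \<forall>t \<in> {0..1}.
          sat L w1 \<psi> \<and> sat L w2 \<psi> \<and> traj_comb t w1 w2 \<in> trajectories X k \<longrightarrow>
          sat L (traj_comb t w1 w2) \<psi>))"

end

theory Submission
  imports Defs
begin

text \<open>Evaluating a formula at step \<open>m\<close> of a trajectory is evaluating it at step 0 of the suffix
  starting at \<open>m\<close>, and taking suffixes commutes with convex combinations. Hence the set of
  trajectories satisfying a convex specification at any given step is closed under convex
  combinations, and each construct of the grammar only imposes a conjunction of such conditions,
  at steps that do not depend on the states.\<close>

text \<open>Rewriting positions as offsets from \<open>i\<close> turns a shift by \<open>n\<close>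
  into associativity of addition.\<close>

lemma ex_ge_iff_ex_add: "(\<exists>m\<ge>i. P m) \<longleftrightarrow> (\<exists>d::nat. P (i + d))"
  by (metis le_add1 le_iff_add)

lemma all_ge_iff_all_add: "(\<forall>m\<ge>i. P m) \<longleftrightarrow> (\<forall>d::nat. P (i + d))"
  by (metis le_add1 le_iff_add)

text \<open>No operator looks back before the current position. The assumption serves the atom case,
  where the letters must correspond.\<close>

lemma sat_at_drop:
  assumes "n \<le> length \<omega>"
  shows "sat_at (drop n \<omega>) i \<psi> \<longleftrightarrow> sat_at \<omega> (n + i) \<psi>"
proof -
  have len: "a < length \<omega> - n \<longleftrightarrow> n + a < length \<omega>" for a
    by auto
  show ?thesis
  proof (induction \<psi> arbitrary: i)
    case (LUntil \<psi>1 \<psi>2)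
    have "(\<forall>k. i \<le> k \<and> k < i + d \<longrightarrow> sat_at \<omega> (n + k) \<psi>1) \<longleftrightarrow>
          (\<forall>k. n + i \<le> k \<and> k < n + (i + d) \<longrightarrow> sat_at \<omega> k \<psi>1)" for d
      by (simp add: imp_conjL all_ge_iff_all_add add.assoc)
    then show ?case
      by (simp add: LUntil len ex_ge_iff_ex_add add.assoc)
  next
    case (LAlwaysB j \<psi>)
    then show ?case
      by (simp add: len imp_conjL all_ge_iff_all_add add.assoc)
  qed (use assms in \<open>simp_all add: len ex_ge_iff_ex_add imp_conjL all_ge_iff_all_add add.assoc\<close>)
qed

lemma drop_traj_comb: "drop n (traj_comb t w1 w2) = traj_comb t (drop n w1) (drop n w2)"
  by (simp add: traj_comb_def drop_map drop_zip)

lemma length_traj_comb [simp]: "length (traj_comb t w1 w2) = min (length w1) (length w2)"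
  by (simp add: traj_comb_def)

lemma drop_in_trajectories: "w \<in> trajectories X k \<Longrightarrow> drop m w \<in> trajectories X (k - m)"
  by (auto simp: trajectories_def dest: in_set_dropD)

lemma convex_spec_sat_at:
  assumes "convex_spec X L N \<psi>" and "m < k" and "k \<le> N" and "t \<in> {0..1}"
    and w: "w1 \<in> trajectories X k" "w2 \<in> trajectories X k" "traj_comb t w1 w2 \<in> trajectories X k"
    and "sat_at (map L w1) m \<psi>" "sat_at (map L w2) m \<psi>"
  shows "sat_at (map L (traj_comb t w1 w2)) m \<psi>"
proof -
  have suffix: "sat L (drop m v) \<psi> \<longleftrightarrow> sat_at (map L v) m \<psi>" if "v \<in> trajectories X k" for v
    using that \<open>m < k\<close> sat_at_drop[of m "map L v" 0 \<psi>]
    by (simp add: sat_def drop_map trajectories_def)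
  have "drop m (traj_comb t w1 w2) \<in> trajectories X (k - m)"
    using w by (simp add: drop_in_trajectories)
  moreover have "sat L (drop m w1) \<psi>" "sat L (drop m w2) \<psi>"
    using assms suffix by auto
  \<comment> \<open>Here convexity is used at the suffix length, so it must cover all lengths up to
    \<open>N\<close>.\<close>
  moreover have "1 \<le> k - m" "k - m \<le> N"
    using assms by auto
  ultimately have "sat L (drop m (traj_comb t w1 w2)) \<psi>"
    using assms drop_in_trajectories[OF w(1), of m] drop_in_trajectories[OF w(2), of m]
    unfolding convex_spec_def drop_traj_comb by blast
  then show ?thesis
    using suffix w by simp
qed

theorem proposition7p7:
  fixes X :: "(real ^ 'n) set"
    and AP :: "'ap set"
    and L :: "real ^ 'n \<Rightarrow> 'ap set"
    and N M :: nat
    and \<psi>1 \<psi>2 \<psi> :: "'ap ltlf"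
  assumes "finite AP"
    and "L \<in> restrict_space borel X \<rightarrow>\<^sub>M count_space (Pow AP)"
    and "atoms \<psi>1 \<subseteq> AP" and "atoms \<psi>2 \<subseteq> AP"
    and "convex_spec X L N \<psi>1" and "convex_spec X L N \<psi>2"
    and "M \<le> N"
    and "\<psi> \<in> {\<psi>1, LAnd \<psi>1 \<psi>2, LNext \<psi>1, LNextB M \<psi>1, LAlways \<psi>1, LAlwaysB M \<psi>1}"
  shows "convex_spec X L N \<psi>"
  unfolding convex_spec_def
proof (intro allI impI ballI, elim conjE)
  fix k w1 w2 and t :: real
  assume k: "1 \<le> k" "k \<le> N" and t: "t \<in> {0..1}"
    and w: "w1 \<in> trajectories X k" "w2 \<in> trajectories X k" "traj_comb t w1 w2 \<in> trajectories X k"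
    and sat: "sat L w1 \<psi>" "sat L w2 \<psi>"
  have len: "length w1 = k" "length w2 = k"
    using w by (auto simp: trajectories_def)
  have step: "sat_at (map L (traj_comb t w1 w2)) m \<phi>"
    if "\<phi> \<in> {\<psi>1, \<psi>2}" "m < k" "sat_at (map L w1) m \<phi>" "sat_at (map L w2) m \<phi>" for \<phi> m
    using that convex_spec_sat_at[OF _ \<open>m < k\<close> k(2) t w] assms(5,6) by auto
  \<comment> \<open>At step 0 each form of \<open>\<psi>\<close> asks for \<open>\<psi>1\<close> or
    \<open>\<psi>2\<close> at fixed positions. For the next and bounded operators, satisfaction by
    \<open>w1\<close> already puts these positions below \<open>k\<close>, and the combination has
    the same length \<open>k\<close>.\<close>
  show "sat L (traj_comb t w1 w2) \<psi>"
    using assms(8) sat k by (auto simp: sat_def len intro!: step[of \<psi>1, simplified] step[of \<psi>2, simplified])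
qed

end
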